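(* Let $f, g \in \mathcal C(\{0,1\}^{\mathbb N})$. Then the following assertions are equivalent: (i) $f$ and $g$ are conjugates, i.e. there is a homeomorphism $h$ of $\{0,1\}^{\mathbb N}$ onto itself with $f=h^{-1}gh$; (ii) there are decreasing null sequences $(\mathcal P_n)$ and $(\mathcal Q_n)$ of partitions of $\{0,1\}^{\mathbb N}$ and surjective graph maps $\nu_{2n-1} : \operatorname{Gr}(f,\mathcal P_{2n-1}) \to \operatorname{Gr}(g,\mathcal Q_{2n-1})$ and $\nu_{2n} : \operatorname{Gr}(g,\mathcal Q_{2n}) \to \operatorname{Gr}(f,\mathcal P_{2n})$ ($n\in\mathbb N$) so that the sequence $(\nu_n)$ commutes with refinements; (iii) there are decreasing null sequences $(\mathcal P_n)$ and $(\mathcal Q_n)$ of partitions of $\{0,1\}^{\mathbb N}$ and surjective graph maps $\nu_{2n-1} : \operatorname{Gr}(f,\mathcal P_{2n-1}) \to \operatorname{Gr}(g,\mathcal Q_{2n-1})$ and $\nu_{2n} : \operatorname{Gr}(g,\mathcal Q_{2n}) \to \operatorname{Gr}(f,\mathcal P_{2n})$ ($n\in\mathbb N$) so that the sequence $(\nu_n)$ asymptotically commutes with refinements.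
   Context: $\mathbb N$ is the set of positive integers; sequences are indexed by $\mathbb N$. $\{0,1\}^{\mathbb N}$ has the product topology and the metric $d(\sigma,\tau)=1/n$, where $n$ is the least positive integer with $\sigma(n)\neq\tau(n)$, and $d(\sigma,\sigma)=0$. $\mathcal C(\{0,1\}^{\mathbb N})$ is the set of all continuous maps from $\{0,1\}^{\mathbb N}$ to itself. A partition of $\{0,1\}^{\mathbb N}$ is a finite collection of nonempty pairwise disjoint clopen sets whose union is $\{0,1\}^{\mathbb N}$. For a finite collection of nonempty subsets of $\{0,1\}^{\mathbb N}$, $\operatorname{mesh}$ is the maximum of the diameters of its members. A partition $\mathcal P$ is a refinement of $\mathcal Q$ if every $a\in\mathcal P$ is contained in some (necessarily unique) $\nu(a)\in\mathcal Q$; the map $\nu:\mathcal P\to\mathcal Q$ is the refinement map. A sequence $(\mathcal P_n)$ of partitions is null if $\operatorname{mesh}(\mathcal P_n)\to0$, and decreasing if $\mathcal P_{n+1}$ is a refinement of $\mathcal P_n$ for every $n$. For a partition $\mathcal P$, $\operatorname{Gr}(f,\mathcal P)$ is the digraph with vertex set $\mathcal P$ in which $\overrightarrow{ab}$ is an edge if and only if $f(a)\cap b\neq\emptyset$. A graph map between digraphs is a map $\phi$ of vertex sets such that $\overrightarrow{\phi(u)\phi(v)}$ is an edge whenever $\overrightarrow{uv}$ is an edge; it is surjective if it is surjective on vertices (not necessarily on edges). Given decreasing null sequences $(\mathcal P_n)$, $(\mathcal Q_n)$ and surjective graph maps $\nu_n$ with $\nu_n:\operatorname{Gr}(f,\mathcal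 P_n)\to\operatorname{Gr}(g,\mathcal Q_n)$ for odd $n$ and $\nu_n:\operatorname{Gr}(g,\mathcal Q_n)\to\operatorname{Gr}(f,\mathcal P_n)$ for even $n$, let $i_n:\mathcal P_{n+1}\to\mathcal P_n$ and $j_n:\mathcal Q_{n+1}\to\mathcal Q_n$ be the refinement maps. The sequence $(\nu_n)$ commutes with refinements if $j_n=\nu_n\circ i_n\circ\nu_{n+1}$ for every odd $n$ and $i_n=\nu_n\circ j_n\circ\nu_{n+1}$ for every even $n$. For odd $n$ and $a\in\mathcal P_n$ put $$\nu_m(a)=\bigcup\{\nu_m(b):b\in\mathcal P_m,\ b\subset a\}\ (m\ge n,\ m\text{ odd}),\quad \nu_m^{-1}(a)=\bigcup\{c: c\in\mathcal Q_m,\ \nu_m(c)\subset a\}\ (m>n,\ m\text{ even}),$$ $$\overline\nu_n(a)=\bigcup\{\nu_m(a):m\ge n,\ m\text{ odd}\}\cup\bigcup\{\nu_m^{-1}(a):m>n,\ m\text{ even}\}.$$ For even $n$ and $c\in\mathcal Q_n$ put $$\nu_m(c)=\bigcup\{\nu_m(b):b\in\mathcal Q_m,\ b\subset c\}\ (m\ge n,\ m\text{ even}),\quad \nu_m^{-1}(c)=\bigcup\{a: a\in\mathcal P_m,\ \nu_m(a)\subset c\}\ (m>n,\ m\text{ odd}),$$ $$\overline\nu_n(c)=\bigcup\{\nu_m(c):m\ge n,\ m\text{ even}\}\cup\bigcup\{\nu_m^{-1}(c):m>n,\ m\text{ odd}\}.$$ The sequence $(\nu_n)$ asymptotically commutes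 with refinements if $\lim_{n\to\infty}\operatorname{mesh}(\{\overline\nu_{2n-1}(a):a\in\mathcal P_{2n-1}\})=0$ and $\lim_{n\to\infty}\operatorname{mesh}(\{\overline\nu_{2n}(c):c\in\mathcal Q_{2n}\})=0$. *)

theory Defs
  imports "HOL-Analysis.Analysis" "Graph_Theory.Pair_Digraph"
begin

section \<open>The Cantor space\<close>

text \<open>Continuity, open and closed sets refer to the product topology that the library puts on
  \<^typ>\<open>nat \<Rightarrow> bool\<close> (with \<^typ>\<open>bool\<close> discrete). The coordinate with index \<open>k\<close> here
  is the one with index \<open>k + 1\<close> in the convention where coordinates are indexed by the
  positive integers.\<close>

type_synonym cantor = "nat \<Rightarrow> bool"

definition cantor_dist :: "cantor \<Rightarrow> cantor \<Rightarrow> real" where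
  "cantor_dist \<sigma> \<tau> = (if \<sigma> = \<tau> then 0 else 1 / real (Suc (LEAST k. \<sigma> k \<noteq> \<tau> k)))"

text \<open>The library's metric on function types is a different one and needs a metric on the codomain,
  so its \<^const>\<open>diameter\<close> is repeated here for \<^const>\<open>cantor_dist\<close>.\<close>

definition cantor_diameter :: "cantor set \<Rightarrow> real" where
  "cantor_diameter S = (if S = {} then 0 else SUP (x, y)\<in>S \<times> S. cantor_dist x y)"

definition mesh :: "cantor set set \<Rightarrow> real" where
  "mesh A = Max (cantor_diameter ` A)"

lemma cantor_dist_less_iff:
  "cantor_dist x y < 1 / real (Suc n) \<longleftrightarrow> (\<forall>i\<le>n. x i = y i)"
proof (cases "x = y")
  case True
  then show ?thesis by (simp add: cantor_dist_def)
next
  case False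
  define k where "k = (LEAST k. x k \<noteq> y k)"
  from False obtain j where "x j \<noteq> y j" by blast
  then have k: "x k \<noteq> y k" unfolding k_def by (rule LeastI)
  have less: "x i = y i" if "i < k" for i
    using not_less_Least that unfolding k_def by blast
  have "cantor_dist x y < 1 / real (Suc n) \<longleftrightarrow> n < k"
    unfolding cantor_dist_def k_def[symmetric] using False by (simp add: field_simps)
  also have "\<dots> \<longleftrightarrow> (\<forall>i\<le>n. x i = y i)"
  proof
    assume "n < k"
    then show "\<forall>i\<le>n. x i = y i" using less by (meson le_less_trans)
  next
    assume "\<forall>i\<le>n. x i = y i"
    then show "n < k" using k not_less by blast
  qed
  finally show ?thesis .
qed

lemma cantor_dist_cases:
  obtains "x = y" "cantor_dist x y = 0" | n where "x \<noteq> y" "cantor_dist x y = 1 / real (Suc n)"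
proof (cases "x = y")
  case True
  with that(1) show ?thesis by (simp add: cantor_dist_def)
next
  case False
  with that(2) show ?thesis unfolding cantor_dist_def by (simp del: of_nat_Suc)
qed

lemma Metric_space_cantor: "Metric_space UNIV cantor_dist"
proof
  show nonneg: "0 \<le> cantor_dist x y" for x y
    by (simp add: cantor_dist_def)
  show "cantor_dist x y = cantor_dist y x" for x y
    unfolding cantor_dist_def by (simp add: eq_commute)
  show "cantor_dist x y = 0 \<longleftrightarrow> x = y" for x y
    unfolding cantor_dist_def by (simp del: of_nat_Suc)
  show "cantor_dist x z \<le> cantor_dist x y + cantor_dist y z" for x y z
  proof (rule cantor_dist_cases[of x z])
    fix n assume n: "cantor_dist x z = 1 / real (Suc n)"
    then have "\<not> (\<forall>i\<le>n. x i = z i)"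
      unfolding cantor_dist_less_iff[symmetric] by simp
    then have "\<not> (\<forall>i\<le>n. x i = y i) \<or> \<not> (\<forall>i\<le>n. y i = z i)" by auto
    then have "cantor_dist x z \<le> cantor_dist x y \<or> cantor_dist x z \<le> cantor_dist y z"
      unfolding n cantor_dist_less_iff[symmetric] by (auto simp: not_less)
    then show ?thesis using nonneg[of x y] nonneg[of y z] by linarith
  qed (use nonneg[of x y] nonneg[of y z] in simp)
qed

lemma open_cantor_iff:
  "open (U :: cantor set) \<longleftrightarrow> (\<forall>x\<in>U. \<exists>n. \<forall>y. (\<forall>i\<le>n. x i = y i) \<longrightarrow> y \<in> U)"
proof (intro iffI ballI)
  fix x assume U: "open U" "x \<in> U"
  then have "openin (product_topology (\<lambda>_. euclidean) UNIV) U"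
    by (simp add: open_fun_def)
  from product_topology_open_contains_basis[OF this \<open>x \<in> U\<close>]
  obtain X where X: "x \<in> PiE UNIV X" "finite {i. X i \<noteq> topspace euclidean}" "PiE UNIV X \<subseteq> U"
    by auto
  then obtain n where n: "\<And>i. X i \<noteq> UNIV \<Longrightarrow> i \<le> n"
    by (auto simp: finite_nat_set_iff_bounded_le)
  show "\<exists>n. \<forall>y. (\<forall>i\<le>n. x i = y i) \<longrightarrow> y \<in> U"
  proof (intro exI allI impI)
    fix y assume y: "\<forall>i\<le>n. x i = y i"
    have "y i \<in> X i" for i
    proof (cases "i \<le> n")
      case True
      with y have "y i = x i" by simp
      with X(1) show ?thesis by (auto simp: PiE_def Pi_def)
    next
      case False
      with n have "X i = UNIV" by blast
      then show ?thesis by simp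
    qed
    with X(3) show "y \<in> U" by (auto simp: PiE_def)
  qed
next
  assume *: "\<forall>x\<in>U. \<exists>n. \<forall>y. (\<forall>i\<le>n. x i = y i) \<longrightarrow> y \<in> U"
  show "open U"
    unfolding open_subopen[of U]
  proof
    fix x assume "x \<in> U"
    with * obtain n where n: "\<And>y. (\<forall>i\<le>n. x i = y i) \<Longrightarrow> y \<in> U" by blast
    have "open ({y. \<forall>i\<in>{..n}. y i \<in> {x i}})"
      by (rule product_topology_basis') (auto intro: open_discrete)
    moreover have "{y. \<forall>i\<in>{..n}. y i \<in> {x i}} \<subseteq> U" using n by auto
    ultimately show "\<exists>T. open T \<and> x \<in> T \<and> T \<subseteq> U" by blast
  qed
qed

lemma mtopology_cantor: "Metric_space.mtopology UNIV cantor_dist = euclidean"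
proof -
  interpret M: Metric_space UNIV cantor_dist by (rule Metric_space_cantor)
  have "openin M.mtopology U \<longleftrightarrow> open U" for U
  proof -
    have "(\<exists>r>0. M.mball x r \<subseteq> U) \<longleftrightarrow> (\<exists>n. \<forall>y. (\<forall>i\<le>n. x i = y i) \<longrightarrow> y \<in> U)" for x
    proof
      assume "\<exists>r>0. M.mball x r \<subseteq> U"
      then obtain r where r: "r > 0" "M.mball x r \<subseteq> U" by blast
      from r(1) obtain n where "1 / real (Suc n) < r"
        by (rule nat_approx_posE)
      with r(2) show "\<exists>n. \<forall>y. (\<forall>i\<le>n. x i = y i) \<longrightarrow> y \<in> U"
      proof (intro exI allI impI)
        fix y assume "\<forall>i\<le>n. x i = y i"
        then have "cantor_dist x y < r"
          using \<open>1 / real (Suc n) < r\<close> unfolding cantor_dist_less_iff[symmetric] by linarith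
        with r(2) show "y \<in> U" by (auto simp: M.mball_def)
      qed
    next
      assume "\<exists>n. \<forall>y. (\<forall>i\<le>n. x i = y i) \<longrightarrow> y \<in> U"
      then obtain n where "\<And>y. (\<forall>i\<le>n. x i = y i) \<Longrightarrow> y \<in> U" by blast
      then have "M.mball x (1 / real (Suc n)) \<subseteq> U"
        unfolding cantor_dist_less_iff[symmetric] by (auto simp: M.mball_def)
      then show "\<exists>r>0. M.mball x r \<subseteq> U"
        by (intro exI[of _ "1 / real (Suc n)"]) simp
    qed
    then show ?thesis by (auto simp: M.openin_mtopology open_cantor_iff)
  qed
  then show ?thesis by (simp add: topology_eq)
qed

section \<open>Partitions\<close>

definition cantor_partition :: "cantor set set \<Rightarrow> bool" where
  "cantor_partition P \<longleftrightarrow> finite P \<and> partition_on UNIV P \<and> (\<forall>a\<in>P. open a \<and> closed a)"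

definition refinement_map :: "cantor set set \<Rightarrow> cantor set \<Rightarrow> cantor set" where
  "refinement_map Q a = (THE b. b \<in> Q \<and> a \<subseteq> b)"

text \<open>All sequences of partitions and of graph maps below are indexed by the positive integers, so
  that the parity of an index has its usual meaning; their values at \<open>0\<close> are irrelevant.\<close>

definition decreasing_null_partitions :: "(nat \<Rightarrow> cantor set set) \<Rightarrow> bool" where
  "decreasing_null_partitions P \<longleftrightarrow>
     (\<forall>n\<ge>1. cantor_partition (P n)) \<and>
     (\<forall>n\<ge>1. refines UNIV (P (Suc n)) (P n)) \<and>
     (\<lambda>n. mesh (P n)) \<longlonglongrightarrow> 0"

section \<open>Graphs and graph maps\<close>

definition Gr :: "(cantor \<Rightarrow> cantor) \<Rightarrow> cantor set set \<Rightarrow> cantor set pair_pre_digraph" where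
  "Gr f P = \<lparr>pverts = P, parcs = {(a, b). a \<in> P \<and> b \<in> P \<and> f ` a \<inter> b \<noteq> {}}\<rparr>"

definition graph_map :: "'a pair_pre_digraph \<Rightarrow> 'b pair_pre_digraph \<Rightarrow> ('a \<Rightarrow> 'b) \<Rightarrow> bool" where
  "graph_map G H \<phi> \<longleftrightarrow>
     \<phi> ` pverts G \<subseteq> pverts H \<and> (\<forall>(u, v)\<in>parcs G. (\<phi> u, \<phi> v) \<in> parcs H)"

definition surjective_graph_map ::
    "'a pair_pre_digraph \<Rightarrow> 'b pair_pre_digraph \<Rightarrow> ('a \<Rightarrow> 'b) \<Rightarrow> bool" where
  "surjective_graph_map G H \<phi> \<longleftrightarrow> graph_map G H \<phi> \<and> \<phi> ` pverts G = pverts H"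

definition alternating_graph_maps ::
    "(cantor \<Rightarrow> cantor) \<Rightarrow> (cantor \<Rightarrow> cantor) \<Rightarrow> (nat \<Rightarrow> cantor set set) \<Rightarrow>
     (nat \<Rightarrow> cantor set set) \<Rightarrow> (nat \<Rightarrow> cantor set \<Rightarrow> cantor set) \<Rightarrow> bool" where
  "alternating_graph_maps f g P Q \<nu> \<longleftrightarrow>
     (\<forall>n\<ge>1. (odd n \<longrightarrow> surjective_graph_map (Gr f (P n)) (Gr g (Q n)) (\<nu> n)) \<and>
            (even n \<longrightarrow> surjective_graph_map (Gr g (Q n)) (Gr f (P n)) (\<nu> n)))"

definition commutes_with_refinements ::
    "(nat \<Rightarrow> cantor set set) \<Rightarrow> (nat \<Rightarrow> cantor set set) \<Rightarrow>
     (nat \<Rightarrow> cantor set \<Rightarrow> cantor set) \<Rightarrow> bool" where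
  "commutes_with_refinements P Q \<nu> \<longleftrightarrow>
     (\<forall>n\<ge>1.
        (odd n \<longrightarrow> (\<forall>c\<in>Q (Suc n).
           refinement_map (Q n) c = \<nu> n (refinement_map (P n) (\<nu> (Suc n) c)))) \<and>
        (even n \<longrightarrow> (\<forall>a\<in>P (Suc n).
           refinement_map (P n) a = \<nu> n (refinement_map (Q n) (\<nu> (Suc n) a)))))"

section \<open>Asymptotic commutation\<close>

text \<open>In the next three definitions \<open>R\<close> is the sequence of partitions that the set \<open>a\<close> comes from and
  \<open>S\<close> is the other one: for \<open>a \<in> R n\<close> they are used with \<open>R = P\<close>, \<open>S = Q\<close> if \<open>n\<close> is odd and with
  \<open>R = Q\<close>, \<open>S = P\<close> if \<open>n\<close> is even.\<close>

definition nu_forward ::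
    "(nat \<Rightarrow> cantor set set) \<Rightarrow> (nat \<Rightarrow> cantor set \<Rightarrow> cantor set) \<Rightarrow> nat \<Rightarrow> cantor set \<Rightarrow> cantor set"
  where "nu_forward R \<nu> m a = \<Union> {\<nu> m b | b. b \<in> R m \<and> b \<subseteq> a}"

definition nu_backward ::
    "(nat \<Rightarrow> cantor set set) \<Rightarrow> (nat \<Rightarrow> cantor set \<Rightarrow> cantor set) \<Rightarrow> nat \<Rightarrow> cantor set \<Rightarrow> cantor set"
  where "nu_backward S \<nu> m a = \<Union> {c. c \<in> S m \<and> \<nu> m c \<subseteq> a}"

definition nu_bar ::
    "(nat \<Rightarrow> cantor set set) \<Rightarrow> (nat \<Rightarrow> cantor set set) \<Rightarrow> (nat \<Rightarrow> cantor set \<Rightarrow> cantor set) \<Rightarrow>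
     nat \<Rightarrow> cantor set \<Rightarrow> cantor set" where
  "nu_bar R S \<nu> n a =
     \<Union> {nu_forward R \<nu> m a | m. m \<ge> n \<and> (even m \<longleftrightarrow> even n)} \<union>
     \<Union> {nu_backward S \<nu> m a | m. m > n \<and> \<not> (even m \<longleftrightarrow> even n)}"

definition asymptotically_commutes_with_refinements ::
    "(nat \<Rightarrow> cantor set set) \<Rightarrow> (nat \<Rightarrow> cantor set set) \<Rightarrow>
     (nat \<Rightarrow> cantor set \<Rightarrow> cantor set) \<Rightarrow> bool" where
  "asymptotically_commutes_with_refinements P Q \<nu> \<longleftrightarrow>
     (\<lambda>n. mesh (nu_bar P Q \<nu> (2 * n - 1) ` P (2 * n - 1))) \<longlonglongrightarrow> 0 \<and>
     (\<lambda>n. mesh (nu_bar Q P \<nu> (2 * n) ` Q (2 * n))) \<longlonglongrightarrow> 0"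

section \<open>Conjugacy\<close>

definition conjugates :: "(cantor \<Rightarrow> cantor) \<Rightarrow> (cantor \<Rightarrow> cantor) \<Rightarrow> bool" where
  "conjugates f g \<longleftrightarrow> (\<exists>h h'. homeomorphism UNIV UNIV h h' \<and> f = h' \<circ> g \<circ> h)"

end

theory Submission
  imports Defs
begin

text \<open>A homeomorphism \<open>h\<close> conjugating \<open>f\<close> to \<open>g\<close> carries a partition \<open>P\<close> to the partition of the images
  \<open>h ` a\<close>, and \<open>a \<mapsto> h ` a\<close> is an isomorphism of the two graphs whose inverse comes from \<open>h\<inverse>\<close>.
  Alternating these two maps along a null sequence whose image under \<open>h\<close> is null as well gives graph
  maps that commute with refinements (\<open>commuting_graph_maps_if_conjugates\<close>).

  If the maps commute with refinements, then everything that \<open>a \<in> P n\<close>, \<open>n\<close> odd, is related to at later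
  stages stays inside the single cell \<open>\<nu> n a\<close>, that is, \<open>nu_bar P Q \<nu> n a \<subseteq> \<nu> n a\<close>; likewise for even
  \<open>n\<close> with \<open>P\<close> and \<open>Q\<close> exchanged (\<open>nu_bar_subset_if_commutes\<close>). As the cells shrink, so do the sets \<open>nu_bar P Q \<nu> n a\<close>, which is
  asymptotic commutation for the same data.

  If the maps commute asymptotically, let \<open>a\<^sub>n\<close> be the cell of \<open>P n\<close> around a point \<open>x\<close>. Along the odd
  \<open>n\<close>, the sets \<open>nu_bar P Q \<nu> n a\<^sub>n\<close> decrease, are nonempty and shrink, so they single out a limit point
  \<open>h x\<close>. The even indices give in the same way a map \<open>k\<close> in the other direction. The two kinds of sets
  that make up \<^const>\<open>nu_bar\<close>, images and preimages, are what makes \<open>k\<close> inverse to \<open>h\<close>: once the image of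
  a late cell around \<open>x\<close> lies in a given cell \<open>c\<close> around \<open>h x\<close>, the point \<open>x\<close> lies in a preimage
  belonging to \<open>c\<close> (\<open>tracks_inverse\<close>). Finally \<open>h \<circ> f = g \<circ> h\<close>, because for each odd \<open>n\<close> the edge
  between the cells around \<open>x\<close> and \<open>f x\<close> is sent to an edge for \<open>g\<close>, which provides a point near \<open>h x\<close>
  whose \<open>g\<close>-image is near \<open>h (f x)\<close> (\<open>tracks_intertwines\<close>).

  The two directions are mirror images of each other. They are treated at once by working with two
  sequences \<open>R\<close>, \<open>S\<close> and the parity \<open>p\<close> of the indices at which \<open>\<nu>\<close> maps from \<open>R\<close> to
  \<open>S\<close>; exchanging \<open>R\<close> with \<open>S\<close> negates \<open>p\<close>.\<close>

section \<open>Sequences of families whose mesh tends to zero\<close>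

text \<open>Agreement up to \<open>N\<close> means diameter less than \<open>1 / (N + 1)\<close>; it makes the limits of meshes below
  statements about coordinates.\<close>

definition agree_upto :: "nat \<Rightarrow> cantor set \<Rightarrow> bool" where
  "agree_upto N S \<longleftrightarrow> (\<forall>x\<in>S. \<forall>y\<in>S. \<forall>i\<le>N. x i = y i)"

lemma agree_uptoD:
  assumes "agree_upto N S" "x \<in> S" "y \<in> S" "i \<le> N"
  shows "x i = y i"
  using assms by (simp add: agree_upto_def)

lemma agree_upto_subset: "S \<subseteq> T \<Longrightarrow> agree_upto N T \<Longrightarrow> agree_upto N S"
  by (simp add: agree_upto_def subset_iff)

lemma open_contains_cylinder:
  fixes U :: "cantor set"
  assumes "open U" "x \<in> U"
  obtains N where "\<forall>y. (\<forall>i\<le>N. x i = y i) \<longrightarrow> y \<in> U"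
proof -
  from assms have "\<exists>N. \<forall>y. (\<forall>i\<le>N. x i = y i) \<longrightarrow> y \<in> U" by (simp add: open_cantor_iff)
  then show ?thesis by (rule exE) (rule that)
qed

lemma cantor_dist_le_1: "cantor_dist x y \<le> 1"
  by (simp add: cantor_dist_def)

lemma cantor_dist_le_diameter:
  assumes "x \<in> S" "y \<in> S"
  shows "cantor_dist x y \<le> cantor_diameter S"
proof -
  have "bdd_above ((\<lambda>(x, y). cantor_dist x y) ` (S \<times> S))"
    by (rule bdd_aboveI[of _ 1]) (auto simp: cantor_dist_le_1)
  then have "(case (x, y) of (x, y) \<Rightarrow> cantor_dist x y) \<le> (SUP (x, y)\<in>S \<times> S. cantor_dist x y)"
    by (rule cSUP_upper[rotated]) (use assms in auto)
  then show ?thesis using assms by (auto simp: cantor_diameter_def)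
qed

lemma agree_upto_if_diameter_less:
  assumes "cantor_diameter S < 1 / real (Suc N)"
  shows "agree_upto N S"
  unfolding agree_upto_def
proof (intro ballI)
  fix x y assume "x \<in> S" "y \<in> S"
  then have "cantor_dist x y < 1 / real (Suc N)"
    using assms cantor_dist_le_diameter le_less_trans by blast
  then show "\<forall>i\<le>N. x i = y i" by (simp only: cantor_dist_less_iff)
qed

lemma diameter_le_if_agree_upto:
  assumes "agree_upto N S"
  shows "cantor_diameter S \<le> 1 / real (Suc N)"
proof (cases "S = {}")
  case False
  have "cantor_dist x y < 1 / real (Suc N)" if "x \<in> S" "y \<in> S" for x y
    unfolding cantor_dist_less_iff using assms that by (auto simp: agree_upto_def)
  then have "(SUP (x, y)\<in>S \<times> S. cantor_dist x y) \<le> 1 / real (Suc N)"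
    using False by (intro cSUP_least) (auto intro: less_imp_le)
  with False show ?thesis by (simp add: cantor_diameter_def)
qed (simp add: cantor_diameter_def)

lemma diameter_nonneg: "0 \<le> cantor_diameter S"
proof (cases "S = {}")
  case False
  then obtain x where "x \<in> S" by blast
  then show ?thesis
    using cantor_dist_le_diameter[of x S x] by (simp add: cantor_dist_def)
qed (simp add: cantor_diameter_def)

text \<open>The index set \<open>n \<ge> 1\<close> suffices because a limit ignores the first term; the
  families have to be nonempty since \<^const>\<open>mesh\<close> is a maximum.\<close>

lemma mesh_tendsto_0_iff:
  assumes fin: "\<And>n. n \<ge> 1 \<Longrightarrow> finite (A n) \<and> A n \<noteq> {}"
  shows "(\<lambda>n. mesh (A n)) \<longlonglongrightarrow> 0 \<longleftrightarrow>
    (\<forall>N. \<forall>\<^sub>F n in sequentially. \<forall>a\<in>A n. agree_upto N a)"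
proof
  assume lim: "(\<lambda>n. mesh (A n)) \<longlonglongrightarrow> 0"
  show "\<forall>N. \<forall>\<^sub>F n in sequentially. \<forall>a\<in>A n. agree_upto N a"
  proof
    fix N
    have "\<forall>\<^sub>F n in sequentially. mesh (A n) < 1 / real (Suc N)"
      by (rule order_tendstoD(2)[OF lim]) simp
    then show "\<forall>\<^sub>F n in sequentially. \<forall>a\<in>A n. agree_upto N a"
      using eventually_ge_at_top[of 1]
    proof eventually_elim
      case (elim n)
      then show ?case
        using fin[of n] by (auto simp: mesh_def intro: agree_upto_if_diameter_less)
    qed
  qed
next
  assume small: "\<forall>N. \<forall>\<^sub>F n in sequentially. \<forall>a\<in>A n. agree_upto N a"
  show "(\<lambda>n. mesh (A n)) \<longlonglongrightarrow> 0"
  proof (rule LIMSEQ_I)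
    fix r :: real assume "0 < r"
    then obtain N where N: "1 / real (Suc N) < r" by (rule nat_approx_posE)
    have "\<forall>\<^sub>F n in sequentially. norm (mesh (A n) - 0) < r"
      using small[rule_format, of N] eventually_ge_at_top[of 1]
    proof eventually_elim
      case (elim n)
      have A: "finite (cantor_diameter ` A n)" "cantor_diameter ` A n \<noteq> {}"
        using fin[of n] elim by auto
      have "mesh (A n) \<in> cantor_diameter ` A n" unfolding mesh_def using A by (rule Max_in)
      then obtain a where "a \<in> A n" "mesh (A n) = cantor_diameter a" by auto
      then show ?case
        using elim(1) diameter_le_if_agree_upto[of N a] diameter_nonneg[of a] N by auto
    qed
    then show "\<exists>M. \<forall>n\<ge>M. norm (mesh (A n) - 0) < r"
      by (simp add: eventually_sequentially)
  qed
qed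

lemma partition_finite_nonempty:
  assumes "cantor_partition A"
  shows "finite A \<and> A \<noteq> {}"
  using assms by (auto simp: cantor_partition_def partition_on_def)

lemma decreasing_null_partitions_iff:
  "decreasing_null_partitions P \<longleftrightarrow>
     (\<forall>n\<ge>1. cantor_partition (P n)) \<and>
     (\<forall>n\<ge>1. refines UNIV (P (Suc n)) (P n)) \<and>
     (\<forall>N. \<forall>\<^sub>F n in sequentially. \<forall>a\<in>P n. agree_upto N a)"
proof (cases "\<forall>n\<ge>1. cantor_partition (P n)")
  case True
  then have "finite (P n) \<and> P n \<noteq> {}" if "n \<ge> 1" for n
    using that partition_finite_nonempty by simp
  note mesh_tendsto_0_iff[OF this]
  with True show ?thesis by (simp add: decreasing_null_partitions_def)
qed (auto simp: decreasing_null_partitions_def)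

section \<open>Conjugate maps have commuting graph maps\<close>

text \<open>Requiring agreement of the points and also of their images under \<open>h\<close> makes these sets and their
  images under \<open>h\<close> shrink simultaneously, without an appeal to uniform continuity.\<close>

definition joint_cylinder :: "(cantor \<Rightarrow> cantor) \<Rightarrow> nat \<Rightarrow> cantor \<Rightarrow> cantor set" where
  "joint_cylinder h n x = {y. \<forall>i<n. y i = x i \<and> h y i = h x i}"

definition joint_cylinders :: "(cantor \<Rightarrow> cantor) \<Rightarrow> nat \<Rightarrow> cantor set set" where
  "joint_cylinders h n = range (joint_cylinder h n)"

lemma finite_joint_cylinders: "finite (joint_cylinders h n)"
proof -
  let ?C = "\<lambda>(s, t). {y. \<forall>i<n. y i = (i \<in> s) \<and> h y i = (i \<in> t)}"
  have "joint_cylinders h n \<subseteq> ?C ` (Pow {..<n} \<times> Pow {..<n})"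
    unfolding joint_cylinders_def
  proof (rule image_subsetI)
    fix x
    have "joint_cylinder h n x = ?C ({i. i < n \<and> x i}, {i. i < n \<and> h x i})"
      by (simp add: joint_cylinder_def)
    then show "joint_cylinder h n x \<in> ?C ` (Pow {..<n} \<times> Pow {..<n})"
      by (rule image_eqI) auto
  qed
  then show ?thesis by (rule finite_subset) simp
qed

lemma clopen_coordinate:
  fixes h :: "cantor \<Rightarrow> cantor"
  assumes "continuous_on UNIV h"
  shows "open {y. h y i = v}" "closed {y. h y i = v}"
proof -
  have c: "continuous_on UNIV (\<lambda>y. h y i)"
    using assms by (rule continuous_on_product_then_coordinatewise)
  show "open {y. h y i = v}" "closed {y. h y i = v}"
    using open_vimage[OF open_discrete[of "{v}"] c] closed_vimage[OF closed_singleton[of v] c]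
    by (simp_all add: vimage_def)
qed

lemma clopen_joint_cylinder:
  assumes "continuous_on UNIV h"
  shows "open (joint_cylinder h n x)" "closed (joint_cylinder h n x)"
proof -
  have eq: "joint_cylinder h n x = (\<Inter>i\<in>{..<n}. {y. y i = x i} \<inter> {y. h y i = h x i})"
    by (auto simp: joint_cylinder_def)
  have "open {y :: cantor. y i = v}" "closed {y :: cantor. y i = v}" for i v
    using clopen_coordinate[of "\<lambda>y. y" i v] by auto
  then show "open (joint_cylinder h n x)" "closed (joint_cylinder h n x)"
    unfolding eq using clopen_coordinate[OF assms] by (auto intro!: open_INT closed_INT)
qed

lemma joint_cylinder_eqI:
  assumes "y \<in> joint_cylinder h n x"
  shows "joint_cylinder h n x = joint_cylinder h n y"
  using assms unfolding joint_cylinder_def by simp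

lemma partition_joint_cylinders: "partition_on UNIV (joint_cylinders h n)"
proof (rule partition_onI)
  fix a b assume "a \<in> joint_cylinders h n" "b \<in> joint_cylinders h n" "a \<noteq> b"
  then show "disjnt a b"
    unfolding joint_cylinders_def disjnt_iff using joint_cylinder_eqI by blast
qed (auto simp: joint_cylinders_def joint_cylinder_def)

lemma joint_cylinder_Suc_subset: "joint_cylinder h (Suc n) x \<subseteq> joint_cylinder h n x"
  by (auto simp: joint_cylinder_def)

lemma decreasing_null_joint_cylinders:
  assumes "continuous_on UNIV h"
  shows "decreasing_null_partitions (joint_cylinders h)"
  unfolding decreasing_null_partitions_iff
proof (intro conjI allI impI)
  show "cantor_partition (joint_cylinders h n)" for n
    using finite_joint_cylinders partition_joint_cylinders clopen_joint_cylinder[OF assms]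
    by (auto simp: cantor_partition_def joint_cylinders_def)
  show "refines UNIV (joint_cylinders h (Suc n)) (joint_cylinders h n)" for n
  proof -
    have "\<exists>b\<in>joint_cylinders h n. a \<subseteq> b" if "a \<in> joint_cylinders h (Suc n)" for a
    proof -
      from that obtain x where "a = joint_cylinder h (Suc n) x"
        by (auto simp: joint_cylinders_def)
      then show ?thesis
        using joint_cylinder_Suc_subset[of h n x] by (auto simp: joint_cylinders_def)
    qed
    then show ?thesis
      by (simp add: refines_def partition_joint_cylinders)
  qed
  show "\<forall>\<^sub>F n in sequentially. \<forall>a\<in>joint_cylinders h n. agree_upto N a" for N
    using eventually_gt_at_top[of N]
    by eventually_elim (auto simp: joint_cylinders_def joint_cylinder_def agree_upto_def)
qed

lemma refinement_map_eqI:
  assumes "partition_on UNIV Q" "b \<in> Q" "a \<subseteq> b" "a \<noteq> {}"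
  shows "refinement_map Q a = b"
  unfolding refinement_map_def
proof (rule the_equality)
  fix b' assume "b' \<in> Q \<and> a \<subseteq> b'"
  with assms show "b' = b"
    using partition_onD2[OF assms(1)] unfolding disjoint_def by blast
qed (use assms in auto)

lemma refinement_map_joint_cylinder:
  "refinement_map (joint_cylinders h n) (joint_cylinder h (Suc n) x) = joint_cylinder h n x"
  by (rule refinement_map_eqI[OF partition_joint_cylinders])
    (auto simp: joint_cylinders_def joint_cylinder_def)

text \<open>The condition defining the joint cylinders of \<open>h\<close> is symmetric in the point and its image, so
  \<open>h\<close> only exchanges its own joint cylinders with those of its inverse.\<close>

lemma image_joint_cylinder:
  assumes "\<And>x. k (h x) = x" "\<And>y. h (k y) = y"
  shows "h ` joint_cylinder h n x = joint_cylinder k n (h x)"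
proof
  show "h ` joint_cylinder h n x \<subseteq> joint_cylinder k n (h x)"
    by (auto simp: joint_cylinder_def assms)
  show "joint_cylinder k n (h x) \<subseteq> h ` joint_cylinder h n x"
  proof
    fix y assume "y \<in> joint_cylinder k n (h x)"
    then have "k y \<in> joint_cylinder h n x" by (auto simp: joint_cylinder_def assms)
    then show "y \<in> h ` joint_cylinder h n x" using assms(2) by (metis imageI)
  qed
qed

lemma surjective_graph_map_image:
  assumes inv: "\<And>x. k (h x) = x" "\<And>y. h (k y) = y" and conj: "\<And>x. h (f x) = g (h x)"
  shows "surjective_graph_map (Gr f (joint_cylinders h n)) (Gr g (joint_cylinders k n)) ((`) h)"
proof -
  have "(`) h ` joint_cylinders h n = (\<lambda>x. joint_cylinder k n (h x)) ` UNIV"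
    by (simp add: joint_cylinders_def image_image image_joint_cylinder[OF inv])
  also have "\<dots> = joint_cylinders k n"
    unfolding joint_cylinders_def using inv(2) by (metis image_image surjI)
  finally have onto: "(`) h ` joint_cylinders h n = joint_cylinders k n" .
  have "g ` h ` a \<inter> h ` b \<noteq> {}" if "f ` a \<inter> b \<noteq> {}" for a b
    using that by (force simp: conj[symmetric])
  with onto show ?thesis
    by (auto simp: surjective_graph_map_def graph_map_def Gr_def)
qed

lemma commuting_graph_maps_if_conjugates:
  assumes "conjugates f g"
  shows "\<exists>P Q \<nu>. decreasing_null_partitions P \<and> decreasing_null_partitions Q \<and>
    alternating_graph_maps f g P Q \<nu> \<and> commutes_with_refinements P Q \<nu>"
proof -
  from assms obtain h k where hk: "homeomorphism UNIV UNIV h k" and f: "f = k \<circ> g \<circ> h"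
    by (auto simp: conjugates_def)
  have inv: "k (h x) = x" "h (k x) = x" for x
    using hk by (auto simp: homeomorphism_def)
  have cont: "continuous_on UNIV h" "continuous_on UNIV k"
    using hk by (auto simp: homeomorphism_def)
  note image_h = image_joint_cylinder[of k h, OF inv]
    and image_k = image_joint_cylinder[of h k, OF inv(2,1)]
  define \<nu> :: "nat \<Rightarrow> cantor set \<Rightarrow> cantor set"
    where "\<nu> n = (if odd n then (`) h else (`) k)" for n
  have "alternating_graph_maps f g (joint_cylinders h) (joint_cylinders k) \<nu>"
    by (simp add: alternating_graph_maps_def \<nu>_def surjective_graph_map_image inv f)
  moreover have "commutes_with_refinements (joint_cylinders h) (joint_cylinders k) \<nu>"
    unfolding commutes_with_refinements_def
  proof (intro allI impI conjI ballI)
    fix n c assume "odd n" "c \<in> joint_cylinders k (Suc n)"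
    moreover from this obtain x where "c = joint_cylinder k (Suc n) x"
      by (auto simp: joint_cylinders_def)
    ultimately show "refinement_map (joint_cylinders k n) c =
        \<nu> n (refinement_map (joint_cylinders h n) (\<nu> (Suc n) c))"
      by (simp add: \<nu>_def refinement_map_joint_cylinder image_h image_k inv)
  next
    fix n a assume "even n" "a \<in> joint_cylinders h (Suc n)"
    moreover from this obtain x where "a = joint_cylinder h (Suc n) x"
      by (auto simp: joint_cylinders_def)
    ultimately show "refinement_map (joint_cylinders h n) a =
        \<nu> n (refinement_map (joint_cylinders k n) (\<nu> (Suc n) a))"
      by (simp add: \<nu>_def refinement_map_joint_cylinder image_h image_k inv)
  qed
  ultimately show ?thesis
    using decreasing_null_joint_cylinders cont by blast
qed

section \<open>Alternating maps between two sequences of partitions\<close>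

text \<open>The proposition \<open>p\<close> tells whether \<open>\<nu>\<close> maps from \<open>R\<close> to \<open>S\<close> at the even or at the odd indices. For
  \<open>R = P\<close>, \<open>S = Q\<close> it is \<^const>\<open>False\<close>.\<close>

locale alternating_partition_maps =
  fixes R S :: "nat \<Rightarrow> cantor set set" and \<nu> :: "nat \<Rightarrow> cantor set \<Rightarrow> cantor set" and p :: bool
  assumes R: "decreasing_null_partitions R" and S: "decreasing_null_partitions S"
    and to_S: "n \<ge> 1 \<Longrightarrow> even n = p \<Longrightarrow> a \<in> R n \<Longrightarrow> \<nu> n a \<in> S n"
    and to_R: "n \<ge> 1 \<Longrightarrow> even n \<noteq> p \<Longrightarrow> c \<in> S n \<Longrightarrow> \<nu> n c \<in> R n"

lemma (in alternating_partition_maps) swap: "alternating_partition_maps S R \<nu> (\<not> p)"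
  using R S to_S to_R by unfold_locales auto

context
  fixes R :: "nat \<Rightarrow> cantor set set"
  assumes R: "decreasing_null_partitions R"
begin

lemma partition_on_term: "n \<ge> 1 \<Longrightarrow> partition_on UNIV (R n)"
  using R by (simp add: decreasing_null_partitions_def cantor_partition_def)

lemma open_cell: "n \<ge> 1 \<Longrightarrow> a \<in> R n \<Longrightarrow> open a"
  using R by (simp add: decreasing_null_partitions_def cantor_partition_def)

lemma cell_nonempty: "n \<ge> 1 \<Longrightarrow> a \<in> R n \<Longrightarrow> a \<noteq> {}"
  using partition_on_term by (auto simp: partition_on_def)

lemma ex_cell: "n \<ge> 1 \<Longrightarrow> \<exists>a\<in>R n. x \<in> a"
  using partition_on_term[of n] by (auto simp: partition_on_def)

lemma cell_unique:
  assumes "n \<ge> 1" "a \<in> R n" "b \<in> R n" "x \<in> a" "x \<in> b"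
  shows "a = b"
  using partition_onD2[OF partition_on_term[OF assms(1)]] assms unfolding disjoint_def by blast

lemma cell_subset_if_meets:
  assumes "1 \<le> n" "n \<le> m" "a \<in> R n" "b \<in> R m" "x \<in> a" "x \<in> b"
  shows "b \<subseteq> a"
  using assms(2,4,6)
proof (induction m arbitrary: b rule: dec_induct)
  case base
  then show ?case using assms cell_unique by blast
next
  case (step m)
  then have "refines UNIV (R (Suc m)) (R m)"
    using R assms(1) by (simp add: decreasing_null_partitions_def)
  then obtain b' where "b' \<in> R m" "b \<subseteq> b'"
    using step.prems(1) by (auto simp: refines_def)
  with step.IH[of b'] step.prems show ?case by blast
qed

lemma refinement_map_cell:
  assumes "n \<ge> 1" "a \<in> R (Suc n)"
  shows "refinement_map (R n) a \<in> R n" "a \<subseteq> refinement_map (R n) a"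
proof -
  have "refines UNIV (R (Suc n)) (R n)"
    using R assms(1) by (simp add: decreasing_null_partitions_def)
  then obtain b where b: "b \<in> R n" "a \<subseteq> b"
    using assms(2) by (auto simp: refines_def)
  moreover have "a \<noteq> {}" using cell_nonempty[of "Suc n"] assms by simp
  ultimately have "refinement_map (R n) a = b"
    by (intro refinement_map_eqI partition_on_term assms)
  with b show "refinement_map (R n) a \<in> R n" "a \<subseteq> refinement_map (R n) a" by auto
qed

end

context alternating_partition_maps
begin

lemma nu_subset_nu_bar:
  "b \<in> R m \<Longrightarrow> b \<subseteq> a \<Longrightarrow> m \<ge> n \<Longrightarrow> even m = even n \<Longrightarrow> \<nu> m b \<subseteq> nu_bar R S \<nu> n a"
  unfolding nu_bar_def nu_forward_def by blast

lemma preimage_subset_nu_bar: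
  "c \<in> S m \<Longrightarrow> \<nu> m c \<subseteq> a \<Longrightarrow> m > n \<Longrightarrow> even m \<noteq> even n \<Longrightarrow> c \<subseteq> nu_bar R S \<nu> n a"
  unfolding nu_bar_def nu_backward_def by blast

lemma nu_bar_subsetI:
  assumes "\<And>m b. m \<ge> n \<Longrightarrow> even m = even n \<Longrightarrow> b \<in> R m \<Longrightarrow> b \<subseteq> a \<Longrightarrow> \<nu> m b \<subseteq> C"
    and "\<And>m c. m > n \<Longrightarrow> even m \<noteq> even n \<Longrightarrow> c \<in> S m \<Longrightarrow> \<nu> m c \<subseteq> a \<Longrightarrow> c \<subseteq> C"
  shows "nu_bar R S \<nu> n a \<subseteq> C"
proof
  fix z assume "z \<in> nu_bar R S \<nu> n a"
  then consider m b where "m \<ge> n" "even m = even n" "b \<in> R m" "b \<subseteq> a" "z \<in> \<nu> m b"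
    | m c where "m > n" "even m \<noteq> even n" "c \<in> S m" "\<nu> m c \<subseteq> a" "z \<in> c"
    unfolding nu_bar_def nu_forward_def nu_backward_def by blast
  then show "z \<in> C" using assms by cases blast+
qed

lemma nu_bar_mono:
  assumes "a' \<subseteq> a" "n \<le> n'" "even n' = even n"
  shows "nu_bar R S \<nu> n' a' \<subseteq> nu_bar R S \<nu> n a"
proof (rule nu_bar_subsetI)
  show "\<nu> m b \<subseteq> nu_bar R S \<nu> n a"
    if "n' \<le> m" "even m = even n'" "b \<in> R m" "b \<subseteq> a'" for m b
    using that assms by (intro nu_subset_nu_bar) auto
  show "c \<subseteq> nu_bar R S \<nu> n a"
    if "n' < m" "even m \<noteq> even n'" "c \<in> S m" "\<nu> m c \<subseteq> a'" for m c
    using that assms by (intro preimage_subset_nu_bar) auto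
qed

lemma nu_bar_nonempty:
  assumes "n \<ge> 1" "even n = p" "a \<in> R n"
  shows "nu_bar R S \<nu> n a \<noteq> {}"
proof -
  have "\<nu> n a \<subseteq> nu_bar R S \<nu> n a" using assms(3) by (intro nu_subset_nu_bar) auto
  then show ?thesis using cell_nonempty[OF S assms(1) to_S[OF assms]] by auto
qed

end

section \<open>Commutation implies asymptotic commutation\<close>

text \<open>This is one half of \<^const>\<open>commutes_with_refinements\<close>, the identities at indices of one parity.\<close>

definition commutes_from :: "(nat \<Rightarrow> cantor set set) \<Rightarrow> (nat \<Rightarrow> cantor set set) \<Rightarrow>
    (nat \<Rightarrow> cantor set \<Rightarrow> cantor set) \<Rightarrow> bool \<Rightarrow> bool" where
  "commutes_from R S \<nu> p \<longleftrightarrow> (\<forall>n\<ge>1. even n = p \<longrightarrow>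
     (\<forall>c\<in>S (Suc n). refinement_map (S n) c = \<nu> n (refinement_map (R n) (\<nu> (Suc n) c))))"

context alternating_partition_maps
begin

text \<open>The identity \<open>j\<^sub>m = \<nu>\<^sub>m \<circ> i\<^sub>m \<circ> \<nu>\<^sub>m\<^sub>+\<^sub>1\<close> says that every cell \<open>c \<in> S (Suc m)\<close> is contained
  in the image of the parent of \<open>\<nu> (Suc m) c\<close>; this settles the preimages in \<^const>\<open>nu_bar\<close>. For the images,
  two consecutive identities give \<open>\<nu> (m + 2) b \<subseteq> \<nu> m b'\<close> with \<open>b'\<close> the grandparent of \<open>b\<close>, and one
  descends to stage \<open>n\<close> in steps of two.\<close>

lemma nu_bar_subset_if_commutes:
  assumes RS: "commutes_from R S \<nu> p" and SR: "commutes_from S R \<nu> (\<not> p)"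
    and n: "n \<ge> 1" "even n = p" and a: "a \<in> R n"
  shows "nu_bar R S \<nu> n a \<subseteq> \<nu> n a"
proof (rule nu_bar_subsetI)
  have down: "c \<subseteq> \<nu> m (refinement_map (R m) (\<nu> (Suc m) c))"
    if "m \<ge> 1" "even m = p" "c \<in> S (Suc m)" for m c
    using RS that refinement_map_cell(2)[OF S that(1,3)] unfolding commutes_from_def by auto
  have parent: "refinement_map (R m) b \<subseteq> a" if "n \<le> m" "b \<in> R (Suc m)" "b \<subseteq> a" for m b
  proof -
    have m: "m \<ge> 1" using n that by simp
    obtain x where "x \<in> b" using cell_nonempty[OF R _ \<open>b \<in> R (Suc m)\<close>] by auto
    then show ?thesis
      using refinement_map_cell[OF R m \<open>b \<in> R (Suc m)\<close>] cell_subset_if_meets[OF R n(1) \<open>n \<le> m\<close> a] \<open>b \<subseteq> a\<close>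
      by blast
  qed
  have forward: "\<nu> (n + 2 * k) b \<subseteq> \<nu> n a" if "b \<in> R (n + 2 * k)" "b \<subseteq> a" for k b
    using that
  proof (induction k arbitrary: b)
    case 0
    then have b: "b \<in> R n" "b \<subseteq> a" by auto
    then obtain x where "x \<in> b" using cell_nonempty[OF R n(1)] by blast
    then have "b = a" using b cell_unique[OF R n(1) b(1) a] by blast
    then show ?case by simp
  next
    case (Suc k)
    let ?m = "n + 2 * k"
    define b1 where "b1 = refinement_map (R (Suc ?m)) b"
    define c where "c = refinement_map (S (Suc ?m)) (\<nu> (Suc (Suc ?m)) b)"
    have m: "?m \<ge> 1" "even ?m = p" and b: "b \<in> R (Suc (Suc ?m))" using n Suc.prems by auto
    have \<nu>b: "\<nu> (Suc (Suc ?m)) b \<in> S (Suc (Suc ?m))" using to_S[OF _ _ b] m by simp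
    have b1: "b1 \<in> R (Suc ?m)" "b1 \<subseteq> a"
      using refinement_map_cell(1)[OF R _ b] parent[OF _ b Suc.prems(2)] by (auto simp: b1_def)
    have c: "c \<in> S (Suc ?m)" "\<nu> (Suc (Suc ?m)) b \<subseteq> c"
      using refinement_map_cell[OF S _ \<nu>b] by (auto simp: c_def)
    have "\<nu> (Suc ?m) c = b1"
      using SR b m unfolding commutes_from_def b1_def c_def by simp
    with down[OF m c(1)] have "c \<subseteq> \<nu> ?m (refinement_map (R ?m) b1)" by simp
    also have "\<dots> \<subseteq> \<nu> n a"
      using Suc.IH[OF refinement_map_cell(1)[OF R m(1) b1(1)]] parent[OF _ b1] by simp
    finally show ?case using c(2) by simp
  qed
  have fwd: "\<nu> m b \<subseteq> \<nu> n a" if "n \<le> m" "even m = even n" "b \<in> R m" "b \<subseteq> a" for m b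
  proof -
    have "even (m - n)" using that by simp
    then obtain k where "m = n + 2 * k" using \<open>n \<le> m\<close> by (metis evenE le_add_diff_inverse)
    then show ?thesis using forward that by simp
  qed
  show "\<nu> m b \<subseteq> \<nu> n a" if "n \<le> m" "even m = even n" "b \<in> R m" "b \<subseteq> a" for m b
    using that by (rule fwd)
  show "c \<subseteq> \<nu> n a" if mc: "n < m" "even m \<noteq> even n" "c \<in> S m" "\<nu> m c \<subseteq> a" for m c
  proof -
    obtain l where m: "m = Suc l" using mc(1) by (cases m) auto
    have l: "n \<le> l" "l \<ge> 1" "even l = p" using mc n m by auto
    have \<nu>c: "\<nu> (Suc l) c \<in> R (Suc l)" using to_R[OF _ _ mc(3)] mc n m by auto
    have "c \<subseteq> \<nu> l (refinement_map (R l) (\<nu> (Suc l) c))" using down[OF l(2,3)] mc(3) by (simp add: m)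
    also have "\<dots> \<subseteq> \<nu> n a"
    proof (rule fwd)
      show "even l = even n" using l(3) n(2) by simp
      show "refinement_map (R l) (\<nu> (Suc l) c) \<in> R l"
        by (rule refinement_map_cell(1)[OF R l(2) \<nu>c])
      show "refinement_map (R l) (\<nu> (Suc l) c) \<subseteq> a"
        using parent[OF l(1) \<nu>c] mc(4) by (simp add: m)
    qed (rule l(1))
    finally show ?thesis .
  qed
qed

text \<open>Likewise one half of \<^const>\<open>asymptotically_commutes_with_refinements\<close>.\<close>

definition shrinking :: bool where
  "shrinking \<longleftrightarrow> (\<forall>N. \<forall>\<^sub>F n in sequentially. even n = p \<longrightarrow>
     (\<forall>a\<in>R n. agree_upto N (nu_bar R S \<nu> n a)))"

lemma shrinking_if_commutes:
  assumes "commutes_from R S \<nu> p" "commutes_from S R \<nu> (\<not> p)"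
  shows shrinking
  unfolding shrinking_def
proof
  fix N
  have "\<forall>\<^sub>F n in sequentially. \<forall>c\<in>S n. agree_upto N c"
    using S by (simp add: decreasing_null_partitions_iff)
  then show "\<forall>\<^sub>F n in sequentially. even n = p \<longrightarrow>
      (\<forall>a\<in>R n. agree_upto N (nu_bar R S \<nu> n a))"
    using eventually_ge_at_top[of 1]
  proof eventually_elim
    case (elim n)
    show ?case
    proof (intro impI ballI)
      fix a assume n: "even n = p" and a: "a \<in> R n"
      have "nu_bar R S \<nu> n a \<subseteq> \<nu> n a"
        by (rule nu_bar_subset_if_commutes[OF assms elim(2) n a])
      moreover have "agree_upto N (\<nu> n a)" using elim(1) to_S[OF elim(2) n a] by simp
      ultimately show "agree_upto N (nu_bar R S \<nu> n a)" by (rule agree_upto_subset)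
    qed
  qed
qed

end

section \<open>Asymptotically commuting graph maps define a conjugacy\<close>

context alternating_partition_maps
begin

text \<open>The point \<open>y\<close> is the limit of the sets \<open>nu_bar R S \<nu> n a\<close> belonging to the cells \<open>a\<close> around \<open>x\<close>. A
  relation is used in place of a map so that the passage to the inverse is a statement about the same
  pair of points with \<open>R\<close> and \<open>S\<close> exchanged.\<close>

definition tracks :: "cantor \<Rightarrow> cantor \<Rightarrow> bool" where
  "tracks x y \<longleftrightarrow> (\<forall>N. \<forall>\<^sub>F n in sequentially. even n = p \<longrightarrow>
     (\<forall>a\<in>R n. x \<in> a \<longrightarrow> (\<forall>z\<in>nu_bar R S \<nu> n a. \<forall>i\<le>N. z i = y i)))"

lemma eventually_parityD:
  assumes "\<forall>\<^sub>F n in sequentially. even n = p \<longrightarrow> \<Phi> n"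
  obtains n where "n > M" "n \<ge> 1" "even n = p" "\<Phi> n"
proof -
  from assms obtain K where K: "\<And>n. n \<ge> K \<Longrightarrow> even n = p \<Longrightarrow> \<Phi> n"
    by (auto simp: eventually_sequentially)
  define n where "n = 2 * (K + M) + (if p then 2 else 1)"
  show ?thesis by (rule that[of n]) (auto simp: n_def intro!: K)
qed

lemma tracksE:
  assumes "tracks x y"
  obtains n where "n > M" "n \<ge> 1" "even n = p"
    "\<And>a z i. a \<in> R n \<Longrightarrow> x \<in> a \<Longrightarrow> z \<in> nu_bar R S \<nu> n a \<Longrightarrow> i \<le> N \<Longrightarrow> z i = y i"
proof -
  obtain n where "n > M" "n \<ge> 1" "even n = p"
      "\<forall>a\<in>R n. x \<in> a \<longrightarrow> (\<forall>z\<in>nu_bar R S \<nu> n a. \<forall>i\<le>N. z i = y i)"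
    by (rule eventually_parityD[OF assms[unfolded tracks_def, rule_format, of N]])
  with that show ?thesis by simp
qed

lemma tracks_unique:
  assumes "tracks x y" "tracks x y'"
  shows "y = y'"
proof
  fix i
  have ev: "\<forall>\<^sub>F n in sequentially. even n = p \<longrightarrow>
      (\<forall>a\<in>R n. x \<in> a \<longrightarrow> (\<forall>z\<in>nu_bar R S \<nu> n a. z i = y i \<and> z i = y' i))"
    using assms[unfolded tracks_def, rule_format, of i] by eventually_elim auto
  obtain n where n: "n \<ge> 1" "even n = p"
      "\<forall>a\<in>R n. x \<in> a \<longrightarrow> (\<forall>z\<in>nu_bar R S \<nu> n a. z i = y i \<and> z i = y' i)"
    by (rule eventually_parityD[OF ev])
  obtain a where "a \<in> R n" "x \<in> a" using ex_cell[OF R n(1)] by blast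
  moreover from this obtain z where "z \<in> nu_bar R S \<nu> n a" using nu_bar_nonempty[OF n(1,2)] by blast
  ultimately have "z i = y i" "z i = y' i" using n(3) by simp_all
  then show "y i = y' i" by simp
qed

text \<open>The limit is built coordinatewise: for each \<open>N\<close> some cell \<open>a N\<close> around \<open>x\<close> has a set \<^const>\<open>nu_bar\<close> on which
  the coordinate \<open>N\<close> is constant, and by monotonicity the sets of all later cells around \<open>x\<close> inherit
  this value.\<close>

lemma tracks_exists:
  assumes shrinking
  shows "\<exists>y. tracks x y"
proof -
  have "\<exists>n a. n \<ge> 1 \<and> even n = p \<and> a \<in> R n \<and> x \<in> a \<and> agree_upto N (nu_bar R S \<nu> n a)" for N
  proof -
    obtain n where n: "n \<ge> 1" "even n = p" "\<forall>a\<in>R n. agree_upto N (nu_bar R S \<nu> n a)"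
      by (rule eventually_parityD[OF assms[unfolded shrinking_def, rule_format, of N]])
    then show ?thesis using ex_cell[OF R n(1)] by blast
  qed
  then obtain n a where na: "\<And>N. n N \<ge> 1" "\<And>N. even (n N) = p" "\<And>N. a N \<in> R (n N)"
    "\<And>N. x \<in> a N" "\<And>N. agree_upto N (nu_bar R S \<nu> (n N) (a N))"
    by metis
  define y where "y N = (SOME z. z \<in> nu_bar R S \<nu> (n N) (a N)) N" for N
  have y: "z N = y N" if z: "z \<in> nu_bar R S \<nu> (n N) (a N)" for z N
  proof -
    have "(SOME z. z \<in> nu_bar R S \<nu> (n N) (a N)) \<in> nu_bar R S \<nu> (n N) (a N)"
      using z by (auto simp: some_in_eq)
    then show ?thesis unfolding y_def by (rule agree_uptoD[OF na(5) z]) simp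
  qed
  have "tracks x y"
    unfolding tracks_def
  proof
    fix N
    show "\<forall>\<^sub>F m in sequentially. even m = p \<longrightarrow>
        (\<forall>b\<in>R m. x \<in> b \<longrightarrow> (\<forall>z\<in>nu_bar R S \<nu> m b. \<forall>i\<le>N. z i = y i))"
      using eventually_ge_at_top[of "Max (n ` {..N})"]
    proof eventually_elim
      case (elim m)
      show ?case
      proof (intro impI ballI allI)
        fix b z i
        assume b: "even m = p" "b \<in> R m" "x \<in> b" and z: "z \<in> nu_bar R S \<nu> m b" and "i \<le> N"
        have "n i \<le> m" using elim \<open>i \<le> N\<close> by (auto simp: Max_ge_iff)
        then have "b \<subseteq> a i"
          using cell_subset_if_meets[OF R na(1) _ na(3) b(2) na(4) b(3)] by blast
        then have "nu_bar R S \<nu> m b \<subseteq> nu_bar R S \<nu> (n i) (a i)"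
          using \<open>n i \<le> m\<close> b na(2) by (intro nu_bar_mono) auto
        with z show "z i = y i" by (intro y) (rule subsetD)
      qed
    qed
  qed
  then show ?thesis by blast
qed

text \<open>It suffices that \<open>x\<close> itself lies in \<open>nu_bar S R \<nu> n c\<close> for each cell \<open>c\<close> around \<open>y\<close>, since these sets
  shrink. As \<open>c\<close> is a neighbourhood of \<open>y\<close>, the image \<open>\<nu> m a\<close> of a late cell \<open>a\<close> around \<open>x\<close> lies in \<open>c\<close>;
  hence \<open>a\<close> is one of the preimages that \<open>nu_bar S R \<nu> n c\<close> collects.\<close>

lemma tracks_inverse:
  assumes xy: "tracks x y" and small: "alternating_partition_maps.shrinking S R \<nu> (\<not> p)"
  shows "alternating_partition_maps.tracks S R \<nu> (\<not> p) y x"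
proof -
  interpret rev: alternating_partition_maps S R \<nu> "\<not> p" by (rule swap)
  have x_in: "x \<in> nu_bar S R \<nu> n c"
    if n: "n \<ge> 1" "even n = (\<not> p)" and c: "c \<in> S n" "y \<in> c" for n c
  proof -
    obtain N where N: "\<forall>z. (\<forall>i\<le>N. y i = z i) \<longrightarrow> z \<in> c"
      by (rule open_contains_cylinder[OF open_cell[OF S n(1) c(1)] c(2)])
    obtain m where m: "m > n" "m \<ge> 1" "even m = p"
        "\<And>a z i. a \<in> R m \<Longrightarrow> x \<in> a \<Longrightarrow> z \<in> nu_bar R S \<nu> m a \<Longrightarrow> i \<le> N \<Longrightarrow> z i = y i"
      by (rule tracksE[OF xy, of n N]) (rule that)
    obtain a where a: "a \<in> R m" "x \<in> a" using ex_cell[OF R m(2)] by blast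
    have "\<nu> m a \<subseteq> nu_bar R S \<nu> m a" using a by (intro nu_subset_nu_bar) auto
    also have "\<dots> \<subseteq> c"
    proof
      fix z assume "z \<in> nu_bar R S \<nu> m a"
      then have "\<forall>i\<le>N. y i = z i" using m(4)[OF a] by simp
      with N show "z \<in> c" by simp
    qed
    finally have "a \<subseteq> nu_bar S R \<nu> n c"
      using m n a by (intro rev.preimage_subset_nu_bar[of a m]) auto
    with a show ?thesis by blast
  qed
  show ?thesis
    unfolding rev.tracks_def
  proof
    fix N
    show "\<forall>\<^sub>F n in sequentially. even n = (\<not> p) \<longrightarrow>
        (\<forall>c\<in>S n. y \<in> c \<longrightarrow> (\<forall>z\<in>nu_bar S R \<nu> n c. \<forall>i\<le>N. z i = x i))"
      using small[unfolded rev.shrinking_def, rule_format, of N] eventually_ge_at_top[of 1]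
    proof eventually_elim
      case (elim n)
      show ?case
      proof (intro impI ballI)
        fix c z assume n: "even n = (\<not> p)" and c: "c \<in> S n" "y \<in> c" and z: "z \<in> nu_bar S R \<nu> n c"
        have "agree_upto N (nu_bar S R \<nu> n c)" using elim(1) n c by simp
        then show "\<forall>i\<le>N. z i = x i"
          using x_in[OF elim(2) n c] z unfolding agree_upto_def by simp
      qed
    qed
  qed
qed

text \<open>A point \<open>x'\<close> in the cell \<open>a\<close> around \<open>x\<close> has its later cells inside \<open>a\<close>, so \<open>h x'\<close> is approximated from
  within \<open>nu_bar R S \<nu> n a\<close>, all of whose points are close to \<open>h x\<close>.\<close>

lemma continuous_if_tracks:
  assumes h: "\<And>x. tracks x (h x)"
  shows "continuous_on UNIV h"
proof -
  have near: "\<exists>M. \<forall>x'. (\<forall>i\<le>M. x i = x' i) \<longrightarrow> (\<forall>i\<le>N. h x i = h x' i)" for x N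
  proof -
    obtain n where n: "n \<ge> 1" "even n = p"
        "\<And>a z i. a \<in> R n \<Longrightarrow> x \<in> a \<Longrightarrow> z \<in> nu_bar R S \<nu> n a \<Longrightarrow> i \<le> N \<Longrightarrow> z i = h x i"
      by (rule tracksE[OF h[of x], of 0 N]) (rule that)
    obtain a where a: "a \<in> R n" "x \<in> a" using ex_cell[OF R n(1)] by blast
    obtain M where M: "\<forall>x'. (\<forall>i\<le>M. x i = x' i) \<longrightarrow> x' \<in> a"
      by (rule open_contains_cylinder[OF open_cell[OF R n(1) a(1)] a(2)])
    have "\<forall>i\<le>N. h x i = h x' i" if "x' \<in> a" for x'
    proof -
      obtain m where m: "m > n" "m \<ge> 1" "even m = p"
          "\<And>b z i. b \<in> R m \<Longrightarrow> x' \<in> b \<Longrightarrow> z \<in> nu_bar R S \<nu> m b \<Longrightarrow> i \<le> N \<Longrightarrow> z i = h x' i"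
        by (rule tracksE[OF h[of x'], of n N]) (rule that)
      obtain b where b: "b \<in> R m" "x' \<in> b" using ex_cell[OF R m(2)] by blast
      obtain z where z: "z \<in> nu_bar R S \<nu> m b"
        using nu_bar_nonempty[OF m(2,3) b(1)] by blast
      have "b \<subseteq> a" using cell_subset_if_meets[OF R n(1) _ a(1) b(1) that b(2)] m(1) by simp
      then have "nu_bar R S \<nu> m b \<subseteq> nu_bar R S \<nu> n a"
        using m n by (intro nu_bar_mono) auto
      with z have "z \<in> nu_bar R S \<nu> n a" by blast
      then show ?thesis using n(3)[OF a] m(4)[OF b z] by simp
    qed
    with M have "\<forall>x'. (\<forall>i\<le>M. x i = x' i) \<longrightarrow> (\<forall>i\<le>N. h x i = h x' i)" by simp
    then show ?thesis by (rule exI)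
  qed
  have "open (h -` U)" if U: "open U" for U
    unfolding open_cantor_iff
  proof
    fix x assume "x \<in> h -` U"
    then have hx: "h x \<in> U" by simp
    obtain N where N: "\<forall>y. (\<forall>i\<le>N. h x i = y i) \<longrightarrow> y \<in> U"
      by (rule open_contains_cylinder[OF U hx])
    obtain M where "\<forall>x'. (\<forall>i\<le>M. x i = x' i) \<longrightarrow> (\<forall>i\<le>N. h x i = h x' i)"
      using near[of x N] by (rule exE)
    with N have "\<forall>x'. (\<forall>i\<le>M. x i = x' i) \<longrightarrow> x' \<in> h -` U" by simp
    then show "\<exists>M. \<forall>x'. (\<forall>i\<le>M. x i = x' i) \<longrightarrow> x' \<in> h -` U" by (rule exI)
  qed
  then show ?thesis by (simp add: continuous_on_open_vimage)
qed

text \<open>The cells \<open>a\<close>, \<open>b\<close> around \<open>x\<close>, \<open>f x\<close> span an edge, hence so do \<open>\<nu> n a\<close> and \<open>\<nu> n b\<close>: some \<open>z\<close> near \<open>y\<close>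
  has \<open>g z\<close> near \<open>w\<close>. Continuity of \<open>g\<close> at \<open>y\<close> does the rest.\<close>

lemma tracks_intertwines:
  assumes edges: "\<And>n. n \<ge> 1 \<Longrightarrow> even n = p \<Longrightarrow> graph_map (Gr f (R n)) (Gr g (S n)) (\<nu> n)"
    and g: "continuous_on UNIV g" and xy: "tracks x y" and fx: "tracks (f x) w"
  shows "w = g y"
proof
  fix i
  have "open {y'. g y' i = g y i}" "y \<in> {y'. g y' i = g y i}"
    using clopen_coordinate[OF g] by simp_all
  then obtain M where M: "\<forall>y'. (\<forall>j\<le>M. y j = y' j) \<longrightarrow> y' \<in> {y'. g y' i = g y i}"
    by (rule open_contains_cylinder)
  have ev: "\<forall>\<^sub>F n in sequentially. even n = p \<longrightarrow>
      (\<forall>a\<in>R n. x \<in> a \<longrightarrow> (\<forall>z\<in>nu_bar R S \<nu> n a. \<forall>j\<le>M. z j = y j)) \<and>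
      (\<forall>b\<in>R n. f x \<in> b \<longrightarrow> (\<forall>z\<in>nu_bar R S \<nu> n b. z i = w i))"
    using xy[unfolded tracks_def, rule_format, of M] fx[unfolded tracks_def, rule_format, of i]
    by eventually_elim auto
  obtain n where n: "n \<ge> 1" "even n = p"
      "(\<forall>a\<in>R n. x \<in> a \<longrightarrow> (\<forall>z\<in>nu_bar R S \<nu> n a. \<forall>j\<le>M. z j = y j)) \<and>
      (\<forall>b\<in>R n. f x \<in> b \<longrightarrow> (\<forall>z\<in>nu_bar R S \<nu> n b. z i = w i))"
    by (rule eventually_parityD[OF ev, of 0]) (rule that)
  obtain a b where ab: "a \<in> R n" "x \<in> a" "b \<in> R n" "f x \<in> b"
    using ex_cell[OF R n(1), of x] ex_cell[OF R n(1), of "f x"] by blast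
  then have "(a, b) \<in> parcs (Gr f (R n))" by (auto simp: Gr_def)
  then have "(\<nu> n a, \<nu> n b) \<in> parcs (Gr g (S n))"
    using edges[OF n(1,2)] by (auto simp: graph_map_def)
  then obtain z where "z \<in> \<nu> n a" "g z \<in> \<nu> n b" by (auto simp: Gr_def)
  moreover have "\<nu> n a \<subseteq> nu_bar R S \<nu> n a" "\<nu> n b \<subseteq> nu_bar R S \<nu> n b"
    using ab by (simp_all add: nu_subset_nu_bar)
  ultimately have "z \<in> nu_bar R S \<nu> n a" "g z \<in> nu_bar R S \<nu> n b" by blast+
  then have "\<forall>j\<le>M. z j = y j" "g z i = w i" using n(3) ab by simp_all
  then show "w i = g y i" using M[rule_format, of z] by simp
qed

lemma conjugates_if_shrinking:
  assumes fwd: shrinking and bwd: "alternating_partition_maps.shrinking S R \<nu> (\<not> p)"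
    and edges: "\<And>n. n \<ge> 1 \<Longrightarrow> even n = p \<Longrightarrow> graph_map (Gr f (R n)) (Gr g (S n)) (\<nu> n)"
    and g: "continuous_on UNIV g"
  shows "conjugates f g"
proof -
  interpret rev: alternating_partition_maps S R \<nu> "\<not> p" by (rule swap)
  obtain h where h: "\<And>x. tracks x (h x)" using tracks_exists[OF fwd] by metis
  obtain k where k: "\<And>y. rev.tracks y (k y)" using rev.tracks_exists[OF bwd] by metis
  have kh: "k (h x) = x" for x
    using rev.tracks_unique[OF k tracks_inverse[OF h bwd]] .
  have hk: "h (k y) = y" for y
    using tracks_unique[OF h] rev.tracks_inverse[OF k] fwd by simp
  have "continuous_on UNIV h" "continuous_on UNIV k"
    using continuous_if_tracks h rev.continuous_if_tracks k by blast+
  then have "homeomorphism UNIV UNIV h k"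
    using kh hk by (intro homeomorphismI) auto
  moreover have "h (f x) = g (h x)" for x
    using tracks_intertwines[OF edges g h h] .
  then have "f = k \<circ> g \<circ> h" by (auto simp: fun_eq_iff kh simp flip: \<open>\<And>x. h (f x) = g (h x)\<close>)
  ultimately show ?thesis unfolding conjugates_def by blast
qed

end

section \<open>Translation to the alternating sequence\<close>

lemma eventually_odd_iff:
  "(\<forall>\<^sub>F n in sequentially. \<Phi> (2 * n - 1)) \<longleftrightarrow> (\<forall>\<^sub>F n in sequentially. even n = False \<longrightarrow> \<Phi> n)"
proof
  assume "\<forall>\<^sub>F n in sequentially. \<Phi> (2 * n - 1)"
  then obtain M where M: "\<And>n. n \<ge> M \<Longrightarrow> \<Phi> (2 * n - 1)" by (auto simp: eventually_sequentially)
  have "\<Phi> n" if n: "n \<ge> 2 * M" "odd n" for n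
  proof -
    obtain k where "n = 2 * k + 1" using n(2) by (rule oddE)
    then show ?thesis using M[of "Suc k"] n(1) by simp
  qed
  then show "\<forall>\<^sub>F n in sequentially. even n = False \<longrightarrow> \<Phi> n"
    by (auto simp: eventually_sequentially)
next
  assume "\<forall>\<^sub>F n in sequentially. even n = False \<longrightarrow> \<Phi> n"
  then obtain M where M: "\<And>n. n \<ge> M \<Longrightarrow> odd n \<Longrightarrow> \<Phi> n" by (auto simp: eventually_sequentially)
  show "\<forall>\<^sub>F n in sequentially. \<Phi> (2 * n - 1)"
    unfolding eventually_sequentially by (intro exI[of _ "Suc M"]) (auto intro!: M)
qed

lemma eventually_even_iff:
  "(\<forall>\<^sub>F n in sequentially. \<Phi> (2 * n)) \<longleftrightarrow> (\<forall>\<^sub>F n in sequentially. even n = True \<longrightarrow> \<Phi> n)"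
proof
  assume "\<forall>\<^sub>F n in sequentially. \<Phi> (2 * n)"
  then obtain M where M: "\<And>n. n \<ge> M \<Longrightarrow> \<Phi> (2 * n)" by (auto simp: eventually_sequentially)
  have "\<Phi> n" if n: "n \<ge> 2 * M" "even n" for n
    using n(2) M n(1) by (auto elim!: evenE)
  then show "\<forall>\<^sub>F n in sequentially. even n = True \<longrightarrow> \<Phi> n"
    by (auto simp: eventually_sequentially)
next
  assume "\<forall>\<^sub>F n in sequentially. even n = True \<longrightarrow> \<Phi> n"
  then obtain M where M: "\<And>n. n \<ge> M \<Longrightarrow> even n \<Longrightarrow> \<Phi> n" by (auto simp: eventually_sequentially)
  show "\<forall>\<^sub>F n in sequentially. \<Phi> (2 * n)"
    unfolding eventually_sequentially by (intro exI[of _ M]) (auto intro!: M)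
qed

lemma alternating_graph_maps_locale:
  assumes "decreasing_null_partitions P" "decreasing_null_partitions Q"
    "alternating_graph_maps f g P Q \<nu>"
  shows "alternating_partition_maps P Q \<nu> False"
proof
  show "\<nu> n a \<in> Q n" if "1 \<le> n" "even n = False" "a \<in> P n" for n a
  proof -
    have "\<nu> n ` P n = Q n"
      using assms(3) that by (simp add: alternating_graph_maps_def surjective_graph_map_def Gr_def)
    with that show ?thesis by blast
  qed
  show "\<nu> n c \<in> P n" if "1 \<le> n" "even n \<noteq> False" "c \<in> Q n" for n c
  proof -
    have "\<nu> n ` Q n = P n"
      using assms(3) that by (simp add: alternating_graph_maps_def surjective_graph_map_def Gr_def)
    with that show ?thesis by blast
  qed
qed (use assms in auto)

lemma asymptotically_commutes_iff:
  assumes "alternating_partition_maps P Q \<nu> False"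
  shows "asymptotically_commutes_with_refinements P Q \<nu> \<longleftrightarrow>
    alternating_partition_maps.shrinking P Q \<nu> False \<and>
    alternating_partition_maps.shrinking Q P \<nu> True"
proof -
  interpret fwd: alternating_partition_maps P Q \<nu> False by (rule assms)
  interpret bwd: alternating_partition_maps Q P \<nu> True using fwd.swap by simp
  have fin: "finite (P n) \<and> P n \<noteq> {}" "finite (Q n) \<and> Q n \<noteq> {}" if "n \<ge> 1" for n
    using fwd.R fwd.S that partition_finite_nonempty
    by (auto simp: decreasing_null_partitions_def)
  have "(\<lambda>n. mesh (nu_bar P Q \<nu> (2 * n - 1) ` P (2 * n - 1))) \<longlonglongrightarrow> 0 \<longleftrightarrow>
      (\<forall>N. \<forall>\<^sub>F n in sequentially.
        \<forall>a\<in>nu_bar P Q \<nu> (2 * n - 1) ` P (2 * n - 1). agree_upto N a)"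
    by (rule mesh_tendsto_0_iff) (simp add: fin)
  also have "\<dots> \<longleftrightarrow> fwd.shrinking"
    unfolding fwd.shrinking_def
  proof (rule all_cong1)
    show "(\<forall>\<^sub>F n in sequentially.
          \<forall>a\<in>nu_bar P Q \<nu> (2 * n - 1) ` P (2 * n - 1). agree_upto N a) \<longleftrightarrow>
        (\<forall>\<^sub>F n in sequentially. even n = False \<longrightarrow>
          (\<forall>a\<in>P n. agree_upto N (nu_bar P Q \<nu> n a)))" for N
      using eventually_odd_iff[of "\<lambda>n. \<forall>a\<in>P n. agree_upto N (nu_bar P Q \<nu> n a)"]
      by simp
  qed
  finally have odd: "(\<lambda>n. mesh (nu_bar P Q \<nu> (2 * n - 1) ` P (2 * n - 1))) \<longlonglongrightarrow> 0 \<longleftrightarrow> fwd.shrinking" .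
  have "(\<lambda>n. mesh (nu_bar Q P \<nu> (2 * n) ` Q (2 * n))) \<longlonglongrightarrow> 0 \<longleftrightarrow>
      (\<forall>N. \<forall>\<^sub>F n in sequentially.
        \<forall>a\<in>nu_bar Q P \<nu> (2 * n) ` Q (2 * n). agree_upto N a)"
    by (rule mesh_tendsto_0_iff) (simp add: fin)
  also have "\<dots> \<longleftrightarrow> bwd.shrinking"
    unfolding bwd.shrinking_def
  proof (rule all_cong1)
    show "(\<forall>\<^sub>F n in sequentially.
          \<forall>a\<in>nu_bar Q P \<nu> (2 * n) ` Q (2 * n). agree_upto N a) \<longleftrightarrow>
        (\<forall>\<^sub>F n in sequentially. even n = True \<longrightarrow>
          (\<forall>a\<in>Q n. agree_upto N (nu_bar Q P \<nu> n a)))" for N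
      using eventually_even_iff[of "\<lambda>n. \<forall>a\<in>Q n. agree_upto N (nu_bar Q P \<nu> n a)"]
      by simp
  qed
  finally show ?thesis
    unfolding asymptotically_commutes_with_refinements_def odd by simp
qed

lemma asymptotically_commutes_if_commutes:
  assumes maps: "alternating_partition_maps P Q \<nu> False"
    and "commutes_with_refinements P Q \<nu>"
  shows "asymptotically_commutes_with_refinements P Q \<nu>"
proof -
  interpret fwd: alternating_partition_maps P Q \<nu> False by (rule maps)
  interpret bwd: alternating_partition_maps Q P \<nu> True using fwd.swap by simp
  have "commutes_from P Q \<nu> False" "commutes_from Q P \<nu> True"
    using assms(2) by (auto simp: commutes_with_refinements_def commutes_from_def)
  then show ?thesis
    using asymptotically_commutes_iff[OF maps] fwd.shrinking_if_commutes bwd.shrinking_if_commutes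
    by simp
qed

lemma conjugates_if_asymptotically_commutes:
  assumes maps: "alternating_partition_maps P Q \<nu> False"
    and "alternating_graph_maps f g P Q \<nu>" "asymptotically_commutes_with_refinements P Q \<nu>"
    and "continuous_on UNIV g"
  shows "conjugates f g"
proof -
  interpret alternating_partition_maps P Q \<nu> False by (rule maps)
  show ?thesis
    using assms asymptotically_commutes_iff[OF maps]
    by (intro conjugates_if_shrinking)
      (auto simp: alternating_graph_maps_def surjective_graph_map_def)
qed

theorem theorem3p4:
  fixes f g :: "cantor \<Rightarrow> cantor"
  assumes "continuous_on UNIV f" and "continuous_on UNIV g"
  shows "(conjugates f g \<longleftrightarrow>
           (\<exists>P Q \<nu>. decreasing_null_partitions P \<and> decreasing_null_partitions Q \<and>
              alternating_graph_maps f g P Q \<nu> \<and> commutes_with_refinements P Q \<nu>)) \<and>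
         (conjugates f g \<longleftrightarrow>
           (\<exists>P Q \<nu>. decreasing_null_partitions P \<and> decreasing_null_partitions Q \<and>
              alternating_graph_maps f g P Q \<nu> \<and> asymptotically_commutes_with_refinements P Q \<nu>))"
    (is "(?conj \<longleftrightarrow> ?commuting) \<and> (?conj \<longleftrightarrow> ?asymptotic)")
proof -
  have "?conj \<Longrightarrow> ?commuting" by (rule commuting_graph_maps_if_conjugates)
  moreover have "?commuting \<Longrightarrow> ?asymptotic"
    by (meson alternating_graph_maps_locale asymptotically_commutes_if_commutes)
  moreover have "?asymptotic \<Longrightarrow> ?conj"
    by (meson alternating_graph_maps_locale conjugates_if_asymptotically_commutes assms(2))
  ultimately show ?thesis by blast
qed

end
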